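(* Let $X$ be a Hausdorff topological space and let $f : X \to X$ be a continuous map. Suppose that the set $P$ of periodic points of $f$ is dense in $X$ and has empty interior in $X$. Then $P \setminus P_n$ is dense in $X$ for every positive integer $n$. (Topological transitivity of $f$ is not assumed.)
   Context: A point $x \in X$ is periodic if $f^{n}(x)=x$ for some positive integer $n$, where $f^n$ is the $n$-fold composition of $f$; the smallest such $n$ is the period of $x$. $P$ denotes the set of all periodic points of $f$, and for a positive integer $n$, $P_n$ denotes the set of all periodic points of period $\le n$. *)

theory Defs
  imports "HOL-Analysis.Analysis"
begin

definition periodic_points :: "'a topology \<Rightarrow> ('a \<Rightarrow> 'a) \<Rightarrow> 'a set" where
  "periodic_points X f = {x \<in> topspace X. \<exists>n>0. (f ^^ n) x = x}"

(* Meaningful only at periodic points; elsewhere LEAST gives an unspecified value. *)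
definition period :: "('a \<Rightarrow> 'a) \<Rightarrow> 'a \<Rightarrow> nat" where
  "period f x = (LEAST n. n > 0 \<and> (f ^^ n) x = x)"

definition periodic_points_le :: "'a topology \<Rightarrow> ('a \<Rightarrow> 'a) \<Rightarrow> nat \<Rightarrow> 'a set" where
  "periodic_points_le X f n = {x \<in> periodic_points X f. period f x \<le> n}"

end

(* The points of period at most n are all fixed by the iterate f^(n!), and the fixed point set of
   this iterate is closed because X is Hausdorff. If an open set U misses P - P_n, then the dense
   set P meets U inside this closed set, so U itself consists of periodic points. *)
theory Submission
  imports Defs
begin

lemma funpow_mult_fixed:
  assumes "(f ^^ k) x = x"
  shows "(f ^^ (k * m)) x = x"
  using assms by (induction m) (simp_all add: funpow_add)

lemma continuous_map_funpow:
  assumes "continuous_map X X f"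
  shows "continuous_map X X (f ^^ k)"
  by (induction k) (auto simp: id_def simp del: o_apply intro: continuous_map_compose assms)

text \<open>This set is the equalizer of \<open>g\<close> and the identity, and two continuous maps
  into a Hausdorff space agree on a closed set.\<close>

lemma closedin_fixed_points:
  assumes "Hausdorff_space X" and "continuous_map X X g"
  shows "closedin X {x \<in> topspace X. g x = x}"
  using assms closedin_continuous_maps_eq[of X X g "\<lambda>x. x"] by simp

text \<open>The period is positive and at most \<open>n\<close>, so it divides
  \<open>fact n\<close>.\<close>

lemma periodic_points_le_fixed_by_fact:
  assumes "x \<in> periodic_points_le X f n"
  shows "(f ^^ fact n) x = x"
proof -
  \<comment> \<open>Some positive return time exists, so the \<open>LEAST\<close> in
    \<open>period\<close> is attained.\<close>
  obtain m where "m > 0 \<and> (f ^^ m) x = x"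
    using assms by (auto simp: periodic_points_le_def periodic_points_def)
  then have "period f x > 0 \<and> (f ^^ period f x) x = x"
    unfolding period_def by (rule LeastI)
  moreover have "period f x \<le> n"
    using assms by (simp add: periodic_points_le_def)
  ultimately show ?thesis
    by (metis One_nat_def Suc_leI dvd_def dvd_fact funpow_mult_fixed)
qed

theorem mainTheorem2:
  fixes X :: "'a topology" and f :: "'a \<Rightarrow> 'a"
  assumes "Hausdorff_space X"
    and "continuous_map X X f"
    and "X closure_of periodic_points X f = topspace X"
    and "X interior_of periodic_points X f = {}"
  shows "\<forall>n>0. X closure_of (periodic_points X f - periodic_points_le X f n) = topspace X"
proof (intro allI impI)
  fix n :: nat
  let ?P = "periodic_points X f"
  let ?Q = "{x \<in> topspace X. (f ^^ fact n) x = x}"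
  have "closedin X ?Q"
    using assms(1,2) by (intro closedin_fixed_points continuous_map_funpow)
  \<comment> \<open>The positive number \<open>fact n\<close> itself witnesses periodicity.\<close>
  have "?Q \<subseteq> ?P"
    by (auto simp: periodic_points_def intro!: exI[of _ "fact n"])
  have "U \<inter> (?P - periodic_points_le X f n) \<noteq> {}" if "openin X U" "U \<noteq> {}" for U
  proof
    assume "U \<inter> (?P - periodic_points_le X f n) = {}"
    \<comment> \<open>By assumption every periodic point in \<open>U\<close> has period at most
      \<open>n\<close>.\<close>
    then have "U \<inter> ?P \<subseteq> ?Q"
      using periodic_points_le_fixed_by_fact[of _ X f n]
      by (auto simp: periodic_points_def)
    \<comment> \<open>Density of \<open>?P\<close> passes to the open set \<open>U\<close>: each
      neighbourhood of a point of \<open>U\<close> can be shrunk into \<open>U\<close> and still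
      meets \<open>?P\<close>.\<close>
    have "U \<subseteq> X closure_of (U \<inter> ?P)"
      using openin_Int_closure_of_subset[OF \<open>openin X U\<close>, of ?P] assms(3)
        openin_subset[OF \<open>openin X U\<close>] by blast
    also have "\<dots> \<subseteq> ?Q"
      using \<open>U \<inter> ?P \<subseteq> ?Q\<close> \<open>closedin X ?Q\<close> by (rule closure_of_minimal)
    finally have "U \<subseteq> X interior_of ?P"
      using \<open>?Q \<subseteq> ?P\<close> \<open>openin X U\<close> by (meson interior_of_maximal order_trans)
    then show False
      using assms(4) \<open>U \<noteq> {}\<close> by blast
  qed
  then show "X closure_of (?P - periodic_points_le X f n) = topspace X"
    by (simp add: dense_intersects_open Int_commute)
qed

end
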